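(* Fix a design $i$ with noise standard deviation $\sigma_i>0$. For each allocated simulation time $T_i\ge0$, let $n_i$ be the number of completed replications, $\bar J_i$ the given sample mean, and $\tilde J_i$ the posterior estimate of the true performance. Then for every $x\in\mathbb{R}$, $$\lim_{T_i\to\infty}\Pr\left\{\sqrt{n_i}\left(\tilde J_i-\bar J_i\right)\le x\right\}=\Phi\left(x/\sigma_i\right),$$ where $\Phi$ is the CDF of $N(0,1)$.
   Context: Replication times: design $i$ is simulated in successive replications. The replication times $t_{i,1},t_{i,2},\ldots$ are i.i.d. copies of a random variable $t_i$ taking positive integer values. Number of completed replications: given the total simulation time $T_i\ge0$, $n_i=n_i(T_i)$ is the random nonnegative integer determined by $\sum_{j=1}^{n_i}t_{i,j}\le T_i<\sum_{j=1}^{n_i+1}t_{i,j}$ (empty sum $=0$). Observations: the $j$-th replication yields $\hat J_i(\xi_j)=J_i+w_i(\xi_j)$, where $J_i$ is the true unknown performance and the noises $w_i(\xi_j)$ are i.i.d. $N(0,\sigma_i^2)$. The observations $\hat J_i$ and the replication times $t_i$ are mutually independent. An incomplete replication gives no output. If $n_i\ge 1$, the estimate is $\bar J_i=\frac1{n_i}\sum_{j=1}^{n_i}\hat J_i(\xi_j)$. Posterior (Bayesian viewpoint): for each $T_i$, $\bar J_i$ is regarded as a given real number (which may depend on $T_i$) and $\tilde J_i$ denotes the posterior estimate of $J_i$, a random variable defined jointly with $n_i$. For $c\ge 1$, the conditional law of $\tilde J_i$ given $n_i=c$ is the posterior law of the mean $J_i$ based on $c$ i.i.d. $N(J_i,\sigma_i^2)$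 observations with sample mean $\bar J_i$, under a flat (noninformative) prior. Given $n_i=0$ (no observation), $\tilde J_i$ has an a priori CDF $G_i^0$. *)

theory Defs
  imports "HOL-Probability.Probability"
begin

text \<open>
  Replication times are indexed from 0, so that \<open>s j\<close> is the duration of the replication
  number \<open>j + 1\<close>.
\<close>

definition num_completed :: "(nat \<Rightarrow> nat) \<Rightarrow> real \<Rightarrow> nat" where
  "num_completed s T =
     (THE n. real (\<Sum>j<n. s j) \<le> T \<and> T < real (\<Sum>j<Suc n. s j))"

lemma num_completed_ex1:
  fixes s :: "nat \<Rightarrow> nat" and T :: real
  assumes pos: "\<And>j. 0 < s j" and T: "0 \<le> T"
  shows "\<exists>!n. real (\<Sum>j<n. s j) \<le> T \<and> T < real (\<Sum>j<Suc n. s j)"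
proof -
  define S where "S n = (\<Sum>j<n. s j)" for n
  have sm: "strict_mono S"
    unfolding strict_mono_Suc_iff S_def using pos by simp
  have "Suc (nat \<lfloor>T\<rfloor>) \<le> S (Suc (nat \<lfloor>T\<rfloor>))"
    using sm strict_mono_imp_increasing by blast
  then have "real (Suc (nat \<lfloor>T\<rfloor>)) \<le> real (S (Suc (nat \<lfloor>T\<rfloor>)))"
    by (simp only: of_nat_le_iff)
  moreover have "T < real (Suc (nat \<lfloor>T\<rfloor>))"
    using T by linarith
  ultimately have "T < real (S (Suc (nat \<lfloor>T\<rfloor>)))"
    by linarith
  then obtain m where m: "T < real (S m)" and least: "\<And>k. k < m \<Longrightarrow> \<not> T < real (S k)"
    using exists_least_iff[of "\<lambda>m. T < real (S m)"] by metis
  have "m \<noteq> 0"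
    using m T by (metis S_def lessThan_0 sum.empty of_nat_0 not_le)
  then obtain n where n: "m = Suc n"
    using not0_implies_Suc by blast
  have ex: "real (S n) \<le> T \<and> T < real (S (Suc n))"
    using m least[of n] n by auto
  have "k = n" if k: "real (S k) \<le> T \<and> T < real (S (Suc k))" for k
  proof -
    have "S k < S (Suc n)" and "S n < S (Suc k)"
      using k ex by linarith+
    then show ?thesis
      using strict_mono_less[OF sm] by (simp add: less_Suc_eq_le)
  qed
  with ex have "\<exists>!n. real (S n) \<le> T \<and> T < real (S (Suc n))"
    by (intro ex1I[of _ n])
  then show ?thesis
    unfolding S_def .
qed

definition normal_likelihood :: "real \<Rightarrow> real list \<Rightarrow> real \<Rightarrow> real" where
  "normal_likelihood \<sigma> ys \<theta> = (\<Prod>y\<leftarrow>ys. normal_density \<theta> \<sigma> y)"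

text \<open>
  Bayes' rule for the unknown mean \<open>\<theta>\<close>, given the observed values \<open>ys\<close> of independent
  \<open>N(\<theta>, \<sigma>\<^sup>2)\<close> variables, with the flat improper prior \<^const>\<open>lborel\<close>.
\<close>

definition flat_posterior :: "real \<Rightarrow> real list \<Rightarrow> real measure" where
  "flat_posterior \<sigma> ys =
     density lborel (\<lambda>\<theta>. ennreal (normal_likelihood \<sigma> ys \<theta>) /
       (\<integral>\<^sup>+ \<theta>'. ennreal (normal_likelihood \<sigma> ys \<theta>') \<partial>lborel))"

text \<open>
  The conditional law of \<open>X\<close> given the event \<open>N = c\<close>; it is meaningful only when this event has
  positive probability.
\<close>

definition cond_law :: "'a measure \<Rightarrow> ('a \<Rightarrow> real) \<Rightarrow> ('a \<Rightarrow> nat) \<Rightarrow> nat \<Rightarrow> real measure" where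
  "cond_law M X N c = distr (uniform_measure M {\<omega> \<in> space M. N \<omega> = c}) borel X"

end

theory Submission
  imports Defs
begin

text \<open>
  Under the flat prior, the posterior of the mean after \<open>c\<close> observations with sample mean \<open>m\<close> is
  exactly \<open>N(m, \<sigma>\<^sup>2 / c)\<close>: completing the square in the likelihood leaves a Gaussian in the mean,
  and normalization cancels the remaining factor (\<open>flat_posterior_eq_normal\<close>).  Hence
  \<open>sqrt c * (J - m)\<close> is exactly \<open>N(0, \<sigma>\<^sup>2)\<close>, a law that no longer depends on \<open>c\<close> or on the data.

  Conditionally on each value \<open>c \<ge> 1\<close> of the number of replications, the event in question therefore
  has probability \<open>\<Phi>(x / \<sigma>)\<close> exactly, so its unconditional probability can differ from
  \<open>\<Phi>(x / \<sigma>)\<close> only by the contribution of the event that no replication is completed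
  (\<open>prob_const_on_positive_cells\<close>).  That event says that the first replication lasts longer
  than \<open>T\<close>; its probability is a tail of a finite random variable, and tends to 0
  (\<open>tail_prob_tendsto_0\<close>).
\<close>

lemma prod_list_normal_density:
  assumes "0 < \<sigma>"
  shows "(\<Prod>y\<leftarrow>ys. normal_density \<theta> \<sigma> y) =
    (1 / sqrt (2 * pi * \<sigma>\<^sup>2)) ^ length ys * exp (- (\<Sum>y\<leftarrow>ys. (y - \<theta>)\<^sup>2) / (2 * \<sigma>\<^sup>2))"
  by (induction ys)
    (simp_all add: normal_density_def exp_add[symmetric] add_divide_distrib diff_divide_distrib mult_ac)

lemma sum_list_square_deviation:
  fixes ys :: "real list"
  shows "(\<Sum>y\<leftarrow>ys. (y - \<theta>)\<^sup>2) = (\<Sum>y\<leftarrow>ys. y\<^sup>2) - 2 * \<theta> * sum_list ys + real (length ys) * \<theta>\<^sup>2"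
  by (induction ys) (simp_all add: power2_eq_square algebra_simps)

text \<open>
  As a function of the mean, the sum of squared deviations is a quadratic polynomial with leading
  coefficient \<open>length ys\<close> and vertex at the sample mean; completing the square puts everything else
  into the factor \<open>K\<close>.
\<close>

lemma normal_likelihood_proportional:
  assumes \<sigma>: "0 < \<sigma>" and ys: "ys \<noteq> []"
  obtains K where "0 < K"
    and "\<And>\<theta>. normal_likelihood \<sigma> ys \<theta> =
      K * normal_density (sum_list ys / real (length ys)) (\<sigma> / sqrt (real (length ys))) \<theta>"
proof
  define c where "c = real (length ys)"
  define m where "m = sum_list ys / c"
  define s where "s = \<sigma> / sqrt c"
  define A where "A = (1 / sqrt (2 * pi * \<sigma>\<^sup>2)) ^ length ys"
  define D where "D = (\<Sum>y\<leftarrow>ys. y\<^sup>2) - c * m\<^sup>2"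
  have c: "0 < c" using ys by (simp add: c_def)
  have s: "0 < s" "s\<^sup>2 = \<sigma>\<^sup>2 / c" using \<sigma> c by (simp_all add: s_def power_divide)
  have A: "0 < A" using \<sigma> by (simp add: A_def)
  show "0 < A * exp (- D / (2 * \<sigma>\<^sup>2)) * sqrt (2 * pi * s\<^sup>2)"
    using A s(1) by simp
  fix \<theta>
  have "sum_list ys = c * m" using c by (simp add: m_def)
  then have "(\<Sum>y\<leftarrow>ys. (y - \<theta>)\<^sup>2) = D + c * (\<theta> - m)\<^sup>2"
    unfolding sum_list_square_deviation D_def c_def[symmetric]
    by (simp add: power2_eq_square algebra_simps)
  moreover have "- (D + c * (\<theta> - m)\<^sup>2) / (2 * \<sigma>\<^sup>2) = - D / (2 * \<sigma>\<^sup>2) + - (\<theta> - m)\<^sup>2 / (2 * s\<^sup>2)"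
    using c \<sigma> by (simp add: s(2) field_simps)
  ultimately have "normal_likelihood \<sigma> ys \<theta> =
      A * (exp (- D / (2 * \<sigma>\<^sup>2)) * exp (- (\<theta> - m)\<^sup>2 / (2 * s\<^sup>2)))"
    unfolding normal_likelihood_def prod_list_normal_density[OF \<sigma>] A_def
    by (simp only: exp_add)
  also have "\<dots> = A * exp (- D / (2 * \<sigma>\<^sup>2)) * sqrt (2 * pi * s\<^sup>2) * normal_density m s \<theta>"
    using s(1) by (simp add: normal_density_def)
  finally show "normal_likelihood \<sigma> ys \<theta> = A * exp (- D / (2 * \<sigma>\<^sup>2)) * sqrt (2 * pi * s\<^sup>2) *
      normal_density (sum_list ys / real (length ys)) (\<sigma> / sqrt (real (length ys))) \<theta>"
    unfolding m_def s_def c_def .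
qed

text \<open>
  Since \<^const>\<open>normal_density\<close> has total mass 1, the normalizing integral in Bayes' rule is the
  constant of proportionality of the likelihood, and it cancels.
\<close>

lemma flat_posterior_eq_normal:
  assumes \<sigma>: "0 < \<sigma>" and ys: "ys \<noteq> []"
  shows "flat_posterior \<sigma> ys =
    density lborel (normal_density (sum_list ys / real (length ys)) (\<sigma> / sqrt (real (length ys))))"
proof -
  let ?d = "normal_density (sum_list ys / real (length ys)) (\<sigma> / sqrt (real (length ys)))"
  obtain K where K: "0 < K" and lik: "\<And>\<theta>. normal_likelihood \<sigma> ys \<theta> = K * ?d \<theta>"
    using normal_likelihood_proportional[OF \<sigma> ys] by metis
  have s: "0 < \<sigma> / sqrt (real (length ys))" using \<sigma> ys by simp
  have "(\<integral>\<^sup>+ \<theta>. ?d \<theta> \<partial>lborel) = 1"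
    using prob_space.emeasure_space_1[OF prob_space_normal_density[OF s]]
    by (simp add: emeasure_density)
  then have Z: "(\<integral>\<^sup>+ \<theta>. ennreal (normal_likelihood \<sigma> ys \<theta>) \<partial>lborel) = ennreal K"
    using K by (simp add: lik ennreal_mult nn_integral_cmult)
  have "ennreal (normal_likelihood \<sigma> ys \<theta>) / ennreal K = ennreal (?d \<theta>)" for \<theta>
    using K by (simp add: lik divide_ennreal)
  then show ?thesis
    unfolding flat_posterior_def Z by simp
qed

lemma measure_normal_scaled_le:
  assumes \<sigma>: "0 < \<sigma>" and c: "0 < c"
  shows "measure (density lborel (normal_density m (\<sigma> / sqrt c))) {\<theta>. sqrt c * (\<theta> - m) \<le> x} =
    cdf std_normal_distribution (x / \<sigma>)"
proof -
  let ?N = "density lborel (normal_density m (\<sigma> / sqrt c))"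
  have s: "0 < \<sigma> / sqrt c" using \<sigma> c by simp
  interpret prob_space ?N by (rule prob_space_normal_density[OF s])
  have "distributed ?N lborel (\<lambda>\<theta>. \<theta>) (normal_density m (\<sigma> / sqrt c))"
    by (auto simp: distributed_def distr_id2 cong: distr_cong)
  then have "distributed ?N lborel (\<lambda>\<theta>. (\<theta> - m) / (\<sigma> / sqrt c)) std_normal_density"
    using normal_standard_normal_convert[OF s] by simp
  then have D: "distr ?N lborel (\<lambda>\<theta>. (\<theta> - m) / (\<sigma> / sqrt c)) = std_normal_distribution"
    by (simp add: distributed_def)
  have "(\<theta> - m) / (\<sigma> / sqrt c) \<le> x / \<sigma> \<longleftrightarrow> sqrt c * (\<theta> - m) \<le> x" for \<theta>
    using divide_le_cancel[of "sqrt c * (\<theta> - m)" \<sigma> x] \<sigma> by (simp add: mult.commute)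
  then have "{\<theta>. sqrt c * (\<theta> - m) \<le> x} = (\<lambda>\<theta>. (\<theta> - m) / (\<sigma> / sqrt c)) -` {..x / \<sigma>} \<inter> space ?N"
    by auto
  then show ?thesis
    unfolding cdf_def D[symmetric] by (subst measure_distr) simp_all
qed

lemma measure_cond_law:
  assumes "prob_space M" and [measurable]: "X \<in> borel_measurable M" "N \<in> measurable M (count_space UNIV)"
    and [measurable]: "A \<in> sets borel"
    and pos: "0 < measure M {\<omega> \<in> space M. N \<omega> = c}"
  shows "measure (cond_law M X N c) A =
    measure M {\<omega> \<in> space M. N \<omega> = c \<and> X \<omega> \<in> A} / measure M {\<omega> \<in> space M. N \<omega> = c}"
proof -
  interpret prob_space M by fact
  have "measure (cond_law M X N c) A =
      measure (uniform_measure M {\<omega> \<in> space M. N \<omega> = c}) (X -` A \<inter> space M)"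
    unfolding cond_law_def by (subst measure_distr) simp_all
  also have "\<dots> = measure M ({\<omega> \<in> space M. N \<omega> = c} \<inter> (X -` A \<inter> space M)) /
      measure M {\<omega> \<in> space M. N \<omega> = c}"
    using pos by (subst measure_uniform_measure) (simp_all add: emeasure_eq_measure)
  also have "{\<omega> \<in> space M. N \<omega> = c} \<inter> (X -` A \<inter> space M) = {\<omega> \<in> space M. N \<omega> = c \<and> X \<omega> \<in> A}"
    by auto
  finally show ?thesis .
qed

text \<open>
  The law of total probability over the values of \<open>N\<close>: the cells \<open>N \<ge> 1\<close> contribute exactly
  \<open>p * prob {N \<ge> 1}\<close>, so only the cell \<open>N = 0\<close> can create a discrepancy from \<open>p\<close>.
\<close>

lemma prob_const_on_positive_cells:
  fixes N :: "'a \<Rightarrow> nat"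
  assumes "prob_space M" and [measurable]: "N \<in> measurable M (count_space UNIV)" "E \<in> sets M"
    and p: "0 \<le> p" "p \<le> 1"
    and cells: "\<And>c. 1 \<le> c \<Longrightarrow> 0 < measure M {\<omega> \<in> space M. N \<omega> = c} \<Longrightarrow>
      measure M {\<omega> \<in> space M. N \<omega> = c \<and> \<omega> \<in> E} = p * measure M {\<omega> \<in> space M. N \<omega> = c}"
  shows "\<bar>measure M E - p\<bar> \<le> measure M {\<omega> \<in> space M. N \<omega> = 0}"
proof -
  interpret prob_space M by fact
  let ?C = "\<lambda>c. {\<omega> \<in> space M. N \<omega> = c}" and ?CE = "\<lambda>c. {\<omega> \<in> space M. N \<omega> = c \<and> \<omega> \<in> E}"
  have "prob (?CE (Suc c)) = p * prob (?C (Suc c))" for c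
  proof (cases "prob (?C (Suc c)) = 0")
    case True
    moreover have "prob (?CE (Suc c)) \<le> prob (?C (Suc c))"
      by (rule finite_measure_mono) auto
    ultimately show ?thesis
      using measure_nonneg[of M "?CE (Suc c)"] by simp
  next
    case False
    then show ?thesis
      using cells[of "Suc c"] by (simp add: zero_less_measure_iff)
  qed
  moreover have "(\<lambda>c. prob (?C (Suc c))) sums prob (\<Union>c. ?C (Suc c))"
    by (rule finite_measure_UNION) (auto simp: disjoint_family_on_def)
  then have "(\<lambda>c. p * prob (?C (Suc c))) sums (p * prob (\<Union>c. ?C (Suc c)))"
    by (rule sums_mult)
  moreover have "(\<lambda>c. prob (?CE (Suc c))) sums prob (\<Union>c. ?CE (Suc c))"
    by (rule finite_measure_UNION) (auto simp: disjoint_family_on_def)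
  ultimately have pos: "prob (\<Union>c. ?CE (Suc c)) = p * prob (\<Union>c. ?C (Suc c))"
    using sums_unique2 by auto
  have N: "N \<omega> = 0 \<or> (\<exists>k. N \<omega> = Suc k)" for \<omega>
    by (cases "N \<omega>") auto
  have "E \<subseteq> space M" by (rule sets.sets_into_space) simp
  then have "E = ?CE 0 \<union> (\<Union>c. ?CE (Suc c))"
    using N by blast
  then have E: "prob E = prob (?CE 0) + prob (\<Union>c. ?CE (Suc c))"
    using finite_measure_Union[of "?CE 0" "\<Union>c. ?CE (Suc c)"] by force
  have "space M = ?C 0 \<union> (\<Union>c. ?C (Suc c))"
    using N by blast
  then have one: "1 = prob (?C 0) + prob (\<Union>c. ?C (Suc c))"
    using finite_measure_Union[of "?C 0" "\<Union>c. ?C (Suc c)"] prob_space by force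
  have rest: "prob (\<Union>c. ?C (Suc c)) = 1 - prob (?C 0)"
    using one by linarith
  have diff: "prob E - p = prob (?CE 0) - p * prob (?C 0)"
    unfolding E pos rest by (simp add: algebra_simps)
  have "prob (?CE 0) \<le> prob (?C 0)"
    by (rule finite_measure_mono) auto
  moreover have "0 \<le> p * prob (?C 0)" "p * prob (?C 0) \<le> prob (?C 0)"
    using p by (simp_all add: mult_left_le_one_le)
  ultimately show ?thesis
    unfolding diff using measure_nonneg[of M "?CE 0"] by linarith
qed

lemma tail_prob_tendsto_0:
  fixes X :: "'a \<Rightarrow> real"
  assumes "prob_space M" and [measurable]: "X \<in> borel_measurable M"
  shows "((\<lambda>T. measure M {\<omega> \<in> space M. T < X \<omega>}) \<longlongrightarrow> 0) at_top"
proof -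
  interpret prob_space M by fact
  interpret D: real_distribution "distr M borel X" by (rule real_distribution_distr) simp
  have "prob {\<omega> \<in> space M. T < X \<omega>} = 1 - cdf (distr M borel X) T" for T
  proof -
    have "X -` {..T} \<inter> space M = space M - {\<omega> \<in> space M. T < X \<omega>}"
      by auto
    then have "cdf (distr M borel X) T = prob (space M - {\<omega> \<in> space M. T < X \<omega>})"
      by (simp add: cdf_def measure_distr)
    then show ?thesis
      by (simp add: prob_compl)
  qed
  moreover have "((\<lambda>T. 1 - cdf (distr M borel X) T) \<longlongrightarrow> 1 - 1) at_top"
    by (intro tendsto_intros D.cdf_lim_at_top_prob)
  ultimately show ?thesis by simp
qed

lemma num_completed_eq_iff:
  assumes "\<And>j. 0 < s j" and "0 \<le> T"
  shows "num_completed s T = c \<longleftrightarrow> real (\<Sum>j<c. s j) \<le> T \<and> T < real (\<Sum>j<Suc c. s j)"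
  using theI'[OF num_completed_ex1[of s T, OF assms]] num_completed_ex1[of s T, OF assms]
  unfolding num_completed_def by blast

lemma measurable_num_completed:
  fixes t :: "nat \<Rightarrow> 'a \<Rightarrow> nat"
  assumes [measurable]: "\<And>j. t j \<in> measurable M (count_space UNIV)"
    and pos: "\<And>j \<omega>. \<omega> \<in> space M \<Longrightarrow> 0 < t j \<omega>" and T: "0 \<le> T"
  shows "(\<lambda>\<omega>. num_completed (\<lambda>j. t j \<omega>) T) \<in> measurable M (count_space UNIV)"
proof -
  have "(\<lambda>\<omega>. num_completed (\<lambda>j. t j \<omega>) T) -` {c} \<inter> space M =
      {\<omega> \<in> space M. real (\<Sum>j<c. t j \<omega>) \<le> T \<and> T < real (\<Sum>j<Suc c. t j \<omega>)}" for c
    using num_completed_eq_iff[of "\<lambda>j. t j \<omega>" T c for \<omega>] pos T by blast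
  then show ?thesis
    by (simp add: measurable_count_space_eq2_countable)
qed

theorem lemma3:
  fixes M :: "'a measure"
    and t :: "nat \<Rightarrow> 'a \<Rightarrow> nat"
    and n :: "real \<Rightarrow> 'a \<Rightarrow> nat"
    and Jbar :: "real \<Rightarrow> real"
    and Jtilde :: "real \<Rightarrow> 'a \<Rightarrow> real"
    and prior0 :: "real measure"
    and \<sigma> x :: real
  assumes "prob_space M"
    and "prob_space.indep_vars M (\<lambda>_. count_space UNIV) t UNIV"
    and "\<And>j. distr M (count_space UNIV) (t j) = distr M (count_space UNIV) (t 0)"
    and "\<And>j \<omega>. \<omega> \<in> space M \<Longrightarrow> 0 < t j \<omega>"
    and "\<And>T \<omega>. 0 \<le> T \<Longrightarrow> \<omega> \<in> space M \<Longrightarrow> n T \<omega> = num_completed (\<lambda>j. t j \<omega>) T"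
    and "0 < \<sigma>"
    and "\<And>T. 0 \<le> T \<Longrightarrow> Jtilde T \<in> borel_measurable M"
    and "\<And>T c. 0 \<le> T \<Longrightarrow> 1 \<le> c \<Longrightarrow> 0 < measure M {\<omega> \<in> space M. n T \<omega> = c} \<Longrightarrow>
           \<exists>ys. length ys = c \<and> sum_list ys / real c = Jbar T \<and>
                cond_law M (Jtilde T) (n T) c = flat_posterior \<sigma> ys"
    and "real_distribution prior0"
    and "\<And>T. 0 \<le> T \<Longrightarrow> 0 < measure M {\<omega> \<in> space M. n T \<omega> = 0} \<Longrightarrow>
           cdf (cond_law M (Jtilde T) (n T) 0) = cdf prior0"
  shows "((\<lambda>T. measure M {\<omega> \<in> space M. sqrt (real (n T \<omega>)) * (Jtilde T \<omega> - Jbar T) \<le> x})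
            \<longlongrightarrow> cdf std_normal_distribution (x / \<sigma>)) at_top"
proof -
  interpret prob_space M by fact
  note pos = assms(4) and n = assms(5) and \<sigma> = assms(6) and Jt = assms(7) and post = assms(8)
  let ?p = "cdf std_normal_distribution (x / \<sigma>)"
  let ?E = "\<lambda>T. {\<omega> \<in> space M. sqrt (real (n T \<omega>)) * (Jtilde T \<omega> - Jbar T) \<le> x}"
  have [measurable]: "t j \<in> measurable M (count_space UNIV)" for j
    using assms(2) by (simp add: indep_vars_def)
  interpret Z: real_distribution std_normal_distribution
    by (rule real_dist_normal_dist)
  have bound: "\<bar>prob (?E T) - ?p\<bar> \<le> prob {\<omega> \<in> space M. real (t 0 \<omega>) > T}" if T: "0 \<le> T" for T
  proof -
    have N[measurable]: "n T \<in> measurable M (count_space UNIV)"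
      using measurable_num_completed[of t M T] pos T
      by (simp add: n cong: measurable_cong)
    note [measurable] = Jt[OF T]
    have "\<bar>prob (?E T) - ?p\<bar> \<le> prob {\<omega> \<in> space M. n T \<omega> = 0}"
    proof (rule prob_const_on_positive_cells)
      show "prob_space M" by fact
      show "n T \<in> measurable M (count_space UNIV)" by fact
      show "?E T \<in> sets M" by measurable
      show "0 \<le> ?p" by (rule Z.cdf_nonneg)
      show "?p \<le> 1" by (rule Z.cdf_bounded_prob)
    next
      fix c :: nat
      assume c: "1 \<le> c" and cpos: "0 < prob {\<omega> \<in> space M. n T \<omega> = c}"
      obtain ys where ys: "length ys = c" "sum_list ys / real c = Jbar T"
        and law: "cond_law M (Jtilde T) (n T) c = flat_posterior \<sigma> ys"
        using post[OF T c cpos] by blast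
      let ?A = "{\<theta>. sqrt (real c) * (\<theta> - Jbar T) \<le> x}"
      have "ys \<noteq> []" using ys(1) c by auto
      then have "measure (cond_law M (Jtilde T) (n T) c) ?A = ?p"
        using measure_normal_scaled_le[OF \<sigma>, of "real c" "Jbar T" x] c
        by (simp add: law flat_posterior_eq_normal[OF \<sigma>] ys)
      moreover have "measure (cond_law M (Jtilde T) (n T) c) ?A =
          prob {\<omega> \<in> space M. n T \<omega> = c \<and> Jtilde T \<omega> \<in> ?A} / prob {\<omega> \<in> space M. n T \<omega> = c}"
        by (rule measure_cond_law) (use cpos assms(1) in simp_all)
      moreover have "{\<omega> \<in> space M. n T \<omega> = c \<and> Jtilde T \<omega> \<in> ?A} =
          {\<omega> \<in> space M. n T \<omega> = c \<and> \<omega> \<in> ?E T}"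
        by auto
      ultimately show "prob {\<omega> \<in> space M. n T \<omega> = c \<and> \<omega> \<in> ?E T} =
          ?p * prob {\<omega> \<in> space M. n T \<omega> = c}"
        using cpos by (simp add: field_simps)
    qed
    also have "{\<omega> \<in> space M. n T \<omega> = 0} = {\<omega> \<in> space M. real (t 0 \<omega>) > T}"
      using num_completed_eq_iff[of "\<lambda>j. t j \<omega>" T 0 for \<omega>] pos T by (auto simp: n)
    finally show ?thesis .
  qed
  have "((\<lambda>T. prob (?E T) - ?p) \<longlongrightarrow> 0) at_top"
  proof (rule Lim_null_comparison)
    show "\<forall>\<^sub>F T in at_top. norm (prob (?E T) - ?p) \<le> prob {\<omega> \<in> space M. real (t 0 \<omega>) > T}"
      using eventually_ge_at_top[of 0] by eventually_elim (simp add: bound)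
    show "((\<lambda>T. prob {\<omega> \<in> space M. real (t 0 \<omega>) > T}) \<longlongrightarrow> 0) at_top"
      by (rule tail_prob_tendsto_0) (use assms(1) in simp_all)
  qed
  then show ?thesis
    by (simp add: LIM_zero_iff)
qed

end
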